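(* Let $G=(V\cup E,\varepsilon)$ be a connected bipartite graph, with $E$ regarded as the set of hyperedges. If $G-e$ is connected for each $e\in E$, then the coefficient of the linear term $y$ in the exterior polynomial $X_G(y)$ is $|V|-1$.
   Context: $G=(V\cup E,\varepsilon)$ denotes a finite simple bipartite graph with non-empty colour classes $V$ and $E$ and edge set $\varepsilon$; the elements of $E$ are called hyperedges. $G-e$ is the graph obtained from $G$ by deleting the vertex $e$ and all edges incident with $e$. For connected $G$, a hypertree of $G$ is a function $f:E\to\{0,1,2,\dots\}$ for which there is a spanning tree $\tau$ of $G$ with $d_\tau(e)=f(e)+1$ for every $e\in E$. For distinct $e,e'\in E$, we say that $e$ can transfer valence to $e'$ with respect to a hypertree $f$ if the function obtained from $f$ by decreasing $f(e)$ by 1 and increasing $f(e')$ by 1 is also a hypertree. Fix a total order on $E$. A hyperedge $e$ is externally inactive with respect to $f$ if there is $e'<e$ such that $e'$ can transfer valence to $e$ with respect to $f$; otherwise it is externally active. Let $\overline{\epsilon}(f)$ be the number of externally inactive hyperedges. The exterior polynomial is $X_G(y)=\sum_f y^{\overline{\epsilon}(f)}$, the sum being over all hypertrees $f$ of $G$. It is known that $X_G$ does not depend on the order on $E$ (but it may depend on which colour class is taken as the set of hyperedges). *)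

theory Defs
  imports
    Graph_Theory.Graph_Theory
    "HOL-Library.FuncSet"
    "HOL-Computational_Algebra.Polynomial"
begin

text \<open>
  Undirected graphs are symmetric digraphs without parallel arcs: an edge between \<open>u\<close> and \<open>v\<close>
  is the pair of arcs \<open>(u, v)\<close>, \<open>(v, u)\<close>, and a finite simple graph is a \<^const>\<open>pair_graph\<close>.
\<close>

definition bipartite_graph :: "'a pair_pre_digraph \<Rightarrow> 'a set \<Rightarrow> 'a set \<Rightarrow> bool" where
  "bipartite_graph G V E \<longleftrightarrow>
     pair_graph G \<and> pverts G = V \<union> E \<and> V \<inter> E = {} \<and> V \<noteq> {} \<and> E \<noteq> {} \<and>
     parcs G \<subseteq> V \<times> E \<union> E \<times> V"

text \<open>
  The library predicates \<^const>\<open>forest\<close> and \<^const>\<open>tree\<close> are not usable here: in a symmetric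
  digraph every edge yields the directed cycle \<open>u, v, u\<close> of length 2. The cycles of a simple
  undirected graph are the directed cycles of length at least 3.
\<close>

definition undirected_forest :: "'a pair_pre_digraph \<Rightarrow> bool" where
  "undirected_forest T \<longleftrightarrow>
     pair_graph T \<and> \<not> (\<exists>p. pre_digraph.cycle (with_proj T) p \<and> 3 \<le> length p)"

definition undirected_tree :: "'a pair_pre_digraph \<Rightarrow> bool" where
  "undirected_tree T \<longleftrightarrow> connected (with_proj T) \<and> undirected_forest T"

definition undirected_spanning_tree :: "'a pair_pre_digraph \<Rightarrow> 'a pair_pre_digraph \<Rightarrow> bool" where
  "undirected_spanning_tree T G \<longleftrightarrow> undirected_tree T \<and> spanning (with_proj T) (with_proj G)"

text \<open>
  Functions on \<open>E\<close> are extensional, so that distinct hypertrees differ on \<open>E\<close>.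
  In a symmetric digraph the out-degree is the undirected degree.
\<close>

definition hypertree :: "'a pair_pre_digraph \<Rightarrow> 'a set \<Rightarrow> ('a \<Rightarrow> nat) \<Rightarrow> bool" where
  "hypertree G E f \<longleftrightarrow>
     f \<in> E \<rightarrow>\<^sub>E UNIV \<and>
     (\<exists>T. undirected_spanning_tree T G \<and> (\<forall>e\<in>E. out_degree (with_proj T) e = f e + 1))"

text \<open>The condition \<open>0 < f e\<close> rules out the truncated subtraction \<open>0 - 1 = 0\<close>.\<close>

definition can_transfer_valence ::
  "'a pair_pre_digraph \<Rightarrow> 'a set \<Rightarrow> ('a \<Rightarrow> nat) \<Rightarrow> 'a \<Rightarrow> 'a \<Rightarrow> bool" where
  "can_transfer_valence G E f e e' \<longleftrightarrow>
     e \<in> E \<and> e' \<in> E \<and> e \<noteq> e' \<and> 0 < f e \<and>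
     hypertree G E (f(e := f e - 1, e' := f e' + 1))"

text \<open>The order on \<open>E\<close> is a relation \<open>r\<close> with \<^term>\<open>linear_order_on E r\<close>; \<open>(x, y) \<in> r\<close> means \<open>x \<le> y\<close>.\<close>

definition externally_inactive ::
  "'a pair_pre_digraph \<Rightarrow> 'a set \<Rightarrow> 'a rel \<Rightarrow> ('a \<Rightarrow> nat) \<Rightarrow> 'a \<Rightarrow> bool" where
  "externally_inactive G E r f e \<longleftrightarrow>
     (\<exists>e'\<in>E. (e', e) \<in> r \<and> e' \<noteq> e \<and> can_transfer_valence G E f e' e)"

definition external_inactivity ::
  "'a pair_pre_digraph \<Rightarrow> 'a set \<Rightarrow> 'a rel \<Rightarrow> ('a \<Rightarrow> nat) \<Rightarrow> nat" where
  "external_inactivity G E r f = card {e \<in> E. externally_inactive G E r f e}"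

definition exterior_polynomial :: "'a pair_pre_digraph \<Rightarrow> 'a set \<Rightarrow> 'a rel \<Rightarrow> int poly" where
  "exterior_polynomial G E r = (\<Sum>f | hypertree G E f. monom 1 (external_inactivity G E r f))"

text \<open>The sum above is never the degenerate sum over an infinite set.\<close>

lemma finite_hypertrees:
  assumes "bipartite_graph G V E"
  shows "finite {f. hypertree G E f}"
proof (rule finite_subset)
  have G: "pair_graph G" and E: "E \<subseteq> pverts G"
    using assms by (auto simp: bipartite_graph_def)
  interpret pair_graph G by (fact G)
  show "finite (E \<rightarrow>\<^sub>E {..card (parcs G)})"
    using finite_subset[OF E] pair_finite_verts by (intro finite_PiE) auto
  show "{f. hypertree G E f} \<subseteq> E \<rightarrow>\<^sub>E {..card (parcs G)}"
  proof
    fix f assume "f \<in> {f. hypertree G E f}"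
    then obtain T where f: "f \<in> E \<rightarrow>\<^sub>E UNIV"
      and T: "undirected_spanning_tree T G"
      and deg: "\<And>e. e \<in> E \<Longrightarrow> out_degree (with_proj T) e = f e + 1"
      by (auto simp: hypertree_def)
    have "parcs T \<subseteq> parcs G"
      using T by (auto simp: undirected_spanning_tree_def spanning_def subgraph_def)
    then have "out_degree (with_proj T) e \<le> card (parcs G)" for e
      unfolding out_degree_def out_arcs_def
      using pair_finite_arcs by (intro card_mono) auto
    then have "f e \<le> card (parcs G)" if "e \<in> E" for e
      using deg[OF that] by (metis add_leD1)
    then show "f \<in> E \<rightarrow>\<^sub>E {..card (parcs G)}"
      using f by auto
  qed
qed

end

theory Submission
  imports Defs
begin

text \<open>
  Hypertrees are the degree vectors of spanning trees, so the exchange property of spanning trees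
  carries over: if \<open>f i < g i\<close>, then some \<open>j\<close> with \<open>g j < f j\<close> can transfer valence to \<open>i\<close> with
  respect to \<open>f\<close>. A transfer to a larger hyperedge increases \<open>\<Sum>e. rank e * f e\<close>, so a maximiser
  \<open>f0\<close> of this weight has no inactive hyperedges. By the exchange property a hypertree \<open>f\<close> whose only
  inactive hyperedge is \<open>k\<close> agrees with \<open>f0\<close> above \<open>k\<close>, satisfies \<open>f k < f0 k\<close>, and is determined by
  \<open>k\<close> and \<open>f k\<close>. Since \<open>G - k\<close> is connected, valence can always be moved away from \<open>k\<close>, hence every
  value below \<open>f0 k\<close> occurs. So the linear coefficient is the sum of the values of \<open>f0\<close>, which is
  \<open>card V - 1\<close>.
\<close>

section \<open>Spanning trees as sets of oriented edges\<close>

text \<open>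
  An undirected edge is represented by one of its two orientations; a relation that contains both
  \<open>(u, v)\<close> and \<open>(v, u)\<close> has a pair of parallel edges, hence is not acyclic.
\<close>

definition linked :: "'a rel \<Rightarrow> 'a rel" where
  "linked D = (D\<^sup>s)\<^sup>*"

text \<open>Says that every edge is a bridge, so acyclicity needs no walks. Loops are excluded
  because \<open>linked\<close> is reflexive.\<close>

definition acyclic_edges :: "'a rel \<Rightarrow> bool" where
  "acyclic_edges D \<longleftrightarrow> (\<forall>(u, v)\<in>D. (u, v) \<notin> linked (D - {(u, v)}))"

definition spanning_edges :: "'a set \<Rightarrow> 'a rel \<Rightarrow> bool" where
  "spanning_edges W D \<longleftrightarrow> D \<subseteq> W \<times> W \<and> W \<times> W \<subseteq> linked D"

definition tree_edges :: "'a set \<Rightarrow> 'a rel \<Rightarrow> bool" where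
  "tree_edges W D \<longleftrightarrow> spanning_edges W D \<and> acyclic_edges D"

section \<open>Linkedness as a generated equivalence relation\<close>

lemma in_symcl_iff: "(u, v) \<in> D\<^sup>s \<longleftrightarrow> (u, v) \<in> D \<or> (v, u) \<in> D"
  by (force simp: symcl_def)

lemma linked_refl [simp]: "(u, u) \<in> linked D"
  by (simp add: linked_def)

lemma linked_sym: "(u, v) \<in> linked D \<Longrightarrow> (v, u) \<in> linked D"
proof -
  have "sym (linked D)"
    unfolding linked_def by (intro sym_rtrancl symI) (auto simp: in_symcl_iff)
  then show "(u, v) \<in> linked D \<Longrightarrow> (v, u) \<in> linked D" by (rule symD)
qed

lemma linked_trans: "(u, v) \<in> linked D \<Longrightarrow> (v, w) \<in> linked D \<Longrightarrow> (u, w) \<in> linked D"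
  unfolding linked_def by (rule rtrancl_trans)

lemma linked_edge: "(u, v) \<in> D \<Longrightarrow> (u, v) \<in> linked D"
  unfolding linked_def by (rule r_into_rtrancl) (simp add: in_symcl_iff)

text \<open>\<open>linked D'\<close> is an equivalence relation, and \<open>linked D\<close> is the
  least one that contains \<open>D\<close>.\<close>

lemma linked_least:
  assumes "D \<subseteq> linked D'"
  shows "linked D \<subseteq> linked D'"
proof clarify
  fix u v assume "(u, v) \<in> linked D"
  then show "(u, v) \<in> linked D'"
    unfolding linked_def[of D]
  proof induction
    case (step y z)
    then have "(y, z) \<in> linked D'"
      using assms by (auto simp: in_symcl_iff intro: linked_sym)
    with step show ?case by (blast intro: linked_trans)
  qed simp
qed

lemma linked_mono: "D \<subseteq> D' \<Longrightarrow> linked D \<subseteq> linked D'"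
  by (meson linked_edge linked_least subrelI subsetD)

text \<open>A walk can be shortened until it crosses the new edge at most once; the last two cases
  are the two directions of crossing.\<close>

lemma linked_insertE:
  assumes "(x, y) \<in> linked (insert (a, b) D)"
  obtains "(x, y) \<in> linked D"
    | "(x, a) \<in> linked D" "(b, y) \<in> linked D"
    | "(x, b) \<in> linked D" "(a, y) \<in> linked D"
proof -
  have "(x, y) \<in> linked D \<or> (x, a) \<in> linked D \<and> (b, y) \<in> linked D
      \<or> (x, b) \<in> linked D \<and> (a, y) \<in> linked D"
    using assms unfolding linked_def[of "insert _ _"]
  proof induction
    case (step y z)
    then consider "(y, z) \<in> linked D" | "y = a" "z = b" | "y = b" "z = a"
      by (auto simp: in_symcl_iff dest: linked_edge linked_sym)
    then show ?case
      by cases (use step.IH in \<open>blast intro: linked_trans linked_sym linked_refl\<close>)+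
  qed simp
  with that show ?thesis by blast
qed

section \<open>Edge sets without cycles\<close>

lemma acyclic_edgesD: "acyclic_edges D \<Longrightarrow> (u, v) \<in> D \<Longrightarrow> (u, v) \<notin> linked (D - {(u, v)})"
  unfolding acyclic_edges_def by (drule (1) bspec) simp

lemma acyclic_edges_subset:
  assumes "acyclic_edges D" "D' \<subseteq> D"
  shows "acyclic_edges D'"
  unfolding acyclic_edges_def
proof clarify
  fix u v assume uv: "(u, v) \<in> D'" "(u, v) \<in> linked (D' - {(u, v)})"
  have "linked (D' - {(u, v)}) \<subseteq> linked (D - {(u, v)})"
    using assms(2) by (intro linked_mono) auto
  with uv assms show False by (auto simp: acyclic_edges_def)
qed

lemma acyclic_edges_empty [simp]: "acyclic_edges {}"
  by (simp add: acyclic_edges_def)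

text \<open>A cycle through an old edge would have to use \<open>(a, b)\<close> as well; the rest of
  that cycle would link \<open>a\<close> to \<open>b\<close> inside \<open>D\<close>.\<close>

lemma acyclic_edges_insert:
  assumes D: "acyclic_edges D" and ab: "(a, b) \<notin> linked D"
  shows "acyclic_edges (insert (a, b) D)"
  unfolding acyclic_edges_def
proof clarify
  fix u v assume uv: "(u, v) \<in> insert (a, b) D"
    and link: "(u, v) \<in> linked (insert (a, b) D - {(u, v)})"
  have "(a, b) \<notin> D" using linked_edge[of a b D] ab by blast
  show False
  proof (cases "(u, v) = (a, b)")
    case True
    then show False using link ab \<open>(a, b) \<notin> D\<close> by simp
  next
    case False
    with uv have "(u, v) \<in> D" by blast
    let ?D = "D - {(u, v)}"
    have uvD: "(u, v) \<notin> linked ?D"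
      using acyclic_edgesD[OF D \<open>(u, v) \<in> D\<close>] .
    have le: "linked ?D \<subseteq> linked D" by (rule linked_mono) auto
    have "insert (a, b) D - {(u, v)} = insert (a, b) ?D" using False by auto
    with link have "(u, v) \<in> linked (insert (a, b) ?D)" by (simp only:)
    moreover have "(x, y) \<in> linked D" if "(x, y) \<in> linked ?D" for x y
      using that le by blast
    moreover have "(u, v) \<in> linked D" using \<open>(u, v) \<in> D\<close> by (rule linked_edge)
    ultimately show False
      using uvD ab by (elim linked_insertE) (metis linked_sym linked_trans)+
  qed
qed

text \<open>Take a maximal acyclic set between \<open>H\<close> and \<open>C\<close>: an edge of
  \<open>C\<close> joining two of its components could still be added.\<close>

lemma acyclic_edges_extend:
  assumes "finite C" "H \<subseteq> C" "acyclic_edges H"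
  obtains M where "H \<subseteq> M" "M \<subseteq> C" "acyclic_edges M" "linked M = linked C"
proof -
  let ?P = "\<lambda>M. H \<subseteq> M \<and> M \<subseteq> C \<and> acyclic_edges M"
  have "finite {M. ?P M}"
    by (rule finite_subset[of _ "Pow C"]) (use assms(1) in auto)
  moreover have "H \<in> {M. ?P M}" using assms by simp
  ultimately have "\<exists>M\<in>{M. ?P M}. \<forall>M'\<in>{M. ?P M}. M \<subseteq> M' \<longrightarrow> M = M'"
    by (intro finite_has_maximal) auto
  then obtain M where M: "?P M" and max: "\<And>M'. ?P M' \<Longrightarrow> M \<subseteq> M' \<Longrightarrow> M = M'"
    by auto
  have "C \<subseteq> linked M"
  proof clarify
    fix a b assume "(a, b) \<in> C"
    show "(a, b) \<in> linked M"
    proof (rule ccontr)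
      assume ab: "(a, b) \<notin> linked M"
      have "acyclic_edges (insert (a, b) M)" using M ab by (intro acyclic_edges_insert) auto
      with M \<open>(a, b) \<in> C\<close> have "M = insert (a, b) M" by (intro max) auto
      then have "(a, b) \<in> M" by (metis insertI1)
      then show False using ab linked_edge[of a b M] by blast
    qed
  qed
  then have "linked M = linked C"
    using M linked_mono linked_least by blast
  with M that show ?thesis by blast
qed

section \<open>The number of edges of a spanning tree\<close>

lemma linked_leaves_set:
  assumes "(u, v) \<in> linked D" "u \<in> S" "v \<notin> S"
  obtains a b where "(a, b) \<in> D\<^sup>s" "a \<in> S" "b \<notin> S"
proof -
  have "v \<in> S \<or> (\<exists>a b. (a, b) \<in> D\<^sup>s \<and> a \<in> S \<and> b \<notin> S)"
    using assms(1) unfolding linked_def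
    by induction (use assms(2) in auto)
  with assms(3) that show ?thesis by blast
qed

text \<open>Grow a connected vertex set \<open>S\<close> from a single vertex, adding one edge
  across its boundary for each new vertex.\<close>

lemma spanning_edges_contains_small:
  assumes "finite W" "W \<noteq> {}" "spanning_edges W D"
  obtains F where "F \<subseteq> D" "card F + 1 = card W" "spanning_edges W F"
proof -
  have D: "D \<subseteq> W \<times> W" "W \<times> W \<subseteq> linked D"
    using assms(3) by (auto simp: spanning_edges_def)
  have "\<exists>S F. S \<subseteq> W \<and> F \<subseteq> D \<and> card S = Suc k \<and> card F = k \<and> S \<times> S \<subseteq> linked F \<and> F \<subseteq> S \<times> S"
    if "k < card W" for k
    using that
  proof (induction k)
    case 0
    obtain w where "w \<in> W" using assms(2) by blast
    then show ?case by (intro exI[of _ "{w}"] exI[of _ "{}"]) auto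
  next
    case (Suc k)
    then obtain S F where SF: "S \<subseteq> W" "F \<subseteq> D" "card S = Suc k" "card F = k"
        "S \<times> S \<subseteq> linked F" "F \<subseteq> S \<times> S"
      by auto
    have "finite S" using SF(1) assms(1) by (rule finite_subset)
    moreover have "finite F" using SF(6) \<open>finite S\<close> by (auto intro: finite_subset)
    ultimately have fin: "finite S" "finite F" .
    obtain u where u: "u \<in> S" using SF(3) by fastforce
    obtain v where v: "v \<in> W" "v \<notin> S"
      using SF(1,3) Suc.prems by (metis nat_neq_iff subsetI subset_antisym)
    then have "(u, v) \<in> linked D" using D u SF(1) by blast
    then obtain a b where ab: "(a, b) \<in> D\<^sup>s" "a \<in> S" "b \<notin> S"
      using u v by (blast elim: linked_leaves_set)
    \<comment> \<open>The boundary edge in the orientation in which it occurs in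
      \<open>D\<close>.\<close>
    define d where "d = (if (a, b) \<in> D then (a, b) else (b, a))"
    have d: "d \<in> D" "d \<notin> F"
      using ab SF(6) by (auto simp: d_def in_symcl_iff)
    have "b \<in> W" using ab D by (auto simp: in_symcl_iff)
    have le: "linked F \<subseteq> linked (insert d F)" by (rule linked_mono) auto
    have ablink: "(a, b) \<in> linked (insert d F)"
      unfolding d_def by (auto intro: linked_edge linked_sym[OF linked_edge])
    have "insert b S \<times> insert b S \<subseteq> linked (insert d F)"
    proof clarify
      \<comment> \<open>Linking every vertex to the hub \<open>a\<close> suffices to link all
        pairs.\<close>
      have star: "(a, x) \<in> linked (insert d F)" if "x \<in> insert b S" for x
        using that ab ablink SF(5) le by blast
      fix x y assume "x \<in> insert b S" "y \<in> insert b S"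
      then show "(x, y) \<in> linked (insert d F)"
        using star by (blast intro: linked_trans linked_sym)
    qed
    moreover have "insert d F \<subseteq> insert b S \<times> insert b S"
      using SF(6) ab by (auto simp: d_def)
    moreover have "card (insert b S) = Suc (Suc k)" "card (insert d F) = Suc k"
      using fin ab d SF by auto
    ultimately show ?case
      using SF(1,2) d \<open>b \<in> W\<close>
      by (intro exI[of _ "insert b S"] exI[of _ "insert d F"]) auto
  qed
  from this[of "card W - 1"] obtain S F where SF: "S \<subseteq> W" "F \<subseteq> D" "card S = card W"
      "card F = card W - 1" "S \<times> S \<subseteq> linked F" "F \<subseteq> S \<times> S"
    using assms(1,2) by (auto simp: card_gt_0_iff)
  then have "S = W" using assms(1) card_subset_eq by blast
  have "card F + 1 = card W" using SF(4) assms(1,2) by (simp add: Suc_leI card_gt_0_iff)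
  with SF \<open>S = W\<close> that show ?thesis by (auto simp: spanning_edges_def)
qed

text \<open>Every edge of a tree is a bridge, so the small spanning subset found above cannot be
  proper.\<close>

lemma card_tree_edges:
  assumes "finite W" "W \<noteq> {}" "tree_edges W D"
  shows "card D + 1 = card W"
proof -
  have sD: "spanning_edges W D" and aD: "acyclic_edges D"
    using assms(3) by (auto simp: tree_edges_def)
  obtain F where F: "F \<subseteq> D" "card F + 1 = card W" "spanning_edges W F"
    by (rule spanning_edges_contains_small[OF assms(1,2) sD])
  have "(u, v) \<in> F" if "(u, v) \<in> D" for u v
  proof (rule ccontr)
    assume "(u, v) \<notin> F"
    then have "linked F \<subseteq> linked (D - {(u, v)})" using F(1) by (intro linked_mono) auto
    moreover have "(u, v) \<in> linked F"
      using F(3) sD that by (auto simp: spanning_edges_def)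
    ultimately show False using acyclic_edgesD[OF aD that] by blast
  qed
  with F(1) have "F = D" by auto
  with F(2) show ?thesis by simp
qed

section \<open>Extending and exchanging spanning trees\<close>

lemma finite_tree_edges: "finite W \<Longrightarrow> tree_edges W D \<Longrightarrow> finite D"
  by (rule finite_subset[of D "W \<times> W"]) (auto simp: tree_edges_def spanning_edges_def)

lemma spanning_edges_mono: "spanning_edges W D \<Longrightarrow> D \<subseteq> C \<Longrightarrow> C \<subseteq> W \<times> W \<Longrightarrow> spanning_edges W C"
  unfolding spanning_edges_def using linked_mono[of D C] by blast

lemma tree_edges_between:
  assumes "finite W" "spanning_edges W C" "H \<subseteq> C" "acyclic_edges H"
  obtains M where "H \<subseteq> M" "M \<subseteq> C" "tree_edges W M"
proof -
  have C: "C \<subseteq> W \<times> W" "W \<times> W \<subseteq> linked C" using assms(2) by (auto simp: spanning_edges_def)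
  then have "finite C" using assms(1) by (auto intro: finite_subset)
  then obtain M where M: "H \<subseteq> M" "M \<subseteq> C" "acyclic_edges M" "linked M = linked C"
    by (rule acyclic_edges_extend[OF _ assms(3,4)])
  then have "tree_edges W M" using C by (auto simp: tree_edges_def spanning_edges_def)
  with M(1,2) that show ?thesis by blast
qed

text \<open>Extend \<open>d\<close> and the common edges of both trees to a tree \<open>M\<close>
  inside \<open>insert d D\<close>. All spanning trees have equally many edges, so \<open>M\<close>
  misses exactly one edge \<open>d'\<close>, which is not a common one.\<close>

lemma tree_edges_exchange:
  assumes "finite W" "W \<noteq> {}" "tree_edges W D" "tree_edges W D'" "d \<in> D' - D"
  obtains d' where "d' \<in> D - D'" "tree_edges W (insert d (D - {d'}))"
proof -
  have finD: "finite D" using finite_tree_edges assms(1,3) by blast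
  have D: "spanning_edges W D" and D': "spanning_edges W D'" "acyclic_edges D'"
    using assms(3,4) by (simp_all add: tree_edges_def)
  have acyclic: "acyclic_edges (insert d (D \<inter> D'))"
    by (rule acyclic_edges_subset[OF D'(2)]) (use assms(5) in blast)
  have "D \<subseteq> W \<times> W" "D' \<subseteq> W \<times> W" using D D'(1) by (simp_all add: spanning_edges_def)
  then have "insert d D \<subseteq> W \<times> W" using assms(5) by blast
  then have spanning: "spanning_edges W (insert d D)"
    by (rule spanning_edges_mono[OF D subset_insertI])
  have "insert d (D \<inter> D') \<subseteq> insert d D" by blast
  then obtain M where M: "insert d (D \<inter> D') \<subseteq> M" "M \<subseteq> insert d D" "tree_edges W M"
    by (rule tree_edges_between[OF assms(1) spanning _ acyclic])
  have "card M = card D"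
    using card_tree_edges[OF assms(1,2,3)] card_tree_edges[OF assms(1,2) M(3)] by simp
  then have "card (insert d D - M) = 1"
    using M(2) finD assms(5) by (subst card_Diff_subset) (auto intro: finite_subset)
  then obtain d' where d': "insert d D - M = {d'}" by (auto simp: card_1_singleton_iff)
  then have "M = insert d D - {d'}"
    using double_diff[OF M(2) order_refl] by simp
  moreover have "d' \<in> insert d D - M" using d' by simp
  then have "d' \<in> D - D'" "d' \<noteq> d" using M(1) by auto
  ultimately have "insert d (D - {d'}) = M" by (simp add: insert_Diff_if)
  with M(3) \<open>d' \<in> D - D'\<close> that show ?thesis by simp
qed

text \<open>Again by counting: a tree between \<open>D - {d'}\<close> and \<open>C\<close> has
  exactly one edge beyond \<open>D - {d'}\<close>. That edge may be \<open>d'\<close>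
  itself.\<close>

lemma tree_edges_reconnect:
  assumes "finite W" "W \<noteq> {}" "tree_edges W D" "d' \<in> D" "spanning_edges W C" "D - {d'} \<subseteq> C"
  obtains d where "d \<in> C" "d \<notin> D - {d'}" "tree_edges W (insert d (D - {d'}))"
proof -
  have finD: "finite D" using finite_tree_edges assms(1,3) by blast
  have "acyclic_edges (D - {d'})"
    using assms(3) by (auto simp: tree_edges_def intro: acyclic_edges_subset[of D "D - {d'}"])
  then obtain M where M: "D - {d'} \<subseteq> M" "M \<subseteq> C" "tree_edges W M"
    by (rule tree_edges_between[OF assms(1,5,6)])
  have "card M = card D"
    using card_tree_edges[OF assms(1,2,3)] card_tree_edges[OF assms(1,2) M(3)] by simp
  moreover have "0 < card D" using finD assms(4) by (auto simp: card_gt_0_iff)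
  ultimately have "card (M - (D - {d'})) = 1"
    using M(1) finD assms(4) by (subst card_Diff_subset) auto
  then obtain d where d: "M - (D - {d'}) = {d}" by (auto simp: card_1_singleton_iff)
  then have "insert d (D - {d'}) = M" using Diff_partition[OF M(1)] by simp
  moreover have "d \<in> M - (D - {d'})" using d by simp
  ultimately show ?thesis using that[of d] M(2,3) by (metis DiffD1 DiffD2 subsetD)
qed

section \<open>Counting in families with the exchange property\<close>

text \<open>One unit moves from \<open>j\<close> to \<open>i\<close>. This is the intended move only
  if \<open>j\<close> and \<open>i\<close> differ and \<open>f j\<close> is positive: otherwise the
  second update overrides the first, or the subtraction is truncated.\<close>

definition shift :: "('a \<Rightarrow> nat) \<Rightarrow> 'a \<Rightarrow> 'a \<Rightarrow> 'a \<Rightarrow> nat" where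
  "shift f j i = f(j := f j - 1, i := f i + 1)"

lemma shift_apply:
  "j \<noteq> i \<Longrightarrow> shift f j i e = (if e = i then f i + 1 else if e = j then f j - 1 else f e)"
  by (simp add: shift_def)

text \<open>Isolates what the count needs from hypertrees: \<open>exchange\<close> is the basis
  exchange of integer polymatroids, and \<open>release\<close> is the contribution of the
  connectedness of \<open>G - i\<close>. The order is encoded by an injective
  \<open>rank\<close>.\<close>

locale exchange_family =
  fixes E :: "'a set" and B :: "('a \<Rightarrow> nat) set" and rank :: "'a \<Rightarrow> nat"
  assumes finite_E: "finite E" and finite_B: "finite B" and B_nonempty: "B \<noteq> {}"
    and inj_rank: "inj_on rank E"
    and B_ext: "f \<in> B \<Longrightarrow> g \<in> B \<Longrightarrow> (\<And>e. e \<in> E \<Longrightarrow> f e = g e) \<Longrightarrow> f = g"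
    and exchange: "f \<in> B \<Longrightarrow> g \<in> B \<Longrightarrow> i \<in> E \<Longrightarrow> f i < g i \<Longrightarrow>
      \<exists>j\<in>E. g j < f j \<and> shift f j i \<in> B"
    and release: "f \<in> B \<Longrightarrow> i \<in> E \<Longrightarrow> 0 < f i \<Longrightarrow> \<exists>j\<in>E. j \<noteq> i \<and> shift f i j \<in> B"
begin

definition inactive :: "('a \<Rightarrow> nat) \<Rightarrow> 'a \<Rightarrow> bool" where
  "inactive f i \<longleftrightarrow> (\<exists>j\<in>E. rank j < rank i \<and> 0 < f j \<and> shift f j i \<in> B)"

definition agree_above :: "'a \<Rightarrow> ('a \<Rightarrow> nat) \<Rightarrow> ('a \<Rightarrow> nat) \<Rightarrow> bool" where
  "agree_above i f g \<longleftrightarrow> (\<forall>e\<in>E. rank i < rank e \<longrightarrow> f e = g e)"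

definition weight :: "('a \<Rightarrow> nat) \<Rightarrow> nat" where
  "weight f = (\<Sum>e\<in>E. rank e * f e)"

text \<open>The weight grows by \<open>rank i - rank j\<close>; all other summands are
  unchanged.\<close>

lemma weight_less_shift:
  assumes "j \<in> E" "i \<in> E" "rank j < rank i" "0 < f j"
  shows "weight f < weight (shift f j i)"
proof -
  have "i \<noteq> j" using assms(3) by auto
  have split: "weight h = rank i * h i + (rank j * h j + (\<Sum>e\<in>E - {i} - {j}. rank e * h e))" for h
    unfolding weight_def using assms(1,2) \<open>i \<noteq> j\<close> finite_E
    by (subst sum.remove[of _ i], simp_all, subst sum.remove[of _ j], simp_all)
  have "(\<Sum>e\<in>E - {i} - {j}. rank e * shift f j i e) = (\<Sum>e\<in>E - {i} - {j}. rank e * f e)"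
    by (intro sum.cong) (auto simp: shift_def)
  moreover obtain m where "f j = Suc m" using assms(4) by (cases "f j") auto
  ultimately show ?thesis
    using split[of f] split[of "shift f j i"] \<open>i \<noteq> j\<close> assms(3) by (simp add: shift_def)
qed

text \<open>The donor \<open>j\<close> provided by \<open>exchange\<close> satisfies
  \<open>g j < f j\<close>, so it is neither \<open>i\<close> nor ranked above \<open>i\<close>,
  where \<open>f\<close> and \<open>g\<close> agree.\<close>

lemma inactive_if_top_less:
  assumes "f \<in> B" "g \<in> B" "i \<in> E" "f i < g i" "agree_above i f g"
  shows "inactive f i"
proof -
  obtain j where j: "j \<in> E" "g j < f j" "shift f j i \<in> B"
    using exchange[OF assms(1-4)] by blast
  have "\<not> rank i < rank j" using j assms(5) by (auto simp: agree_above_def)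
  moreover have "rank j \<noteq> rank i"
    using j assms(3,4) inj_onD[OF inj_rank, of j i] by auto
  ultimately show ?thesis
    using j unfolding inactive_def by (metis gr_zeroI less_nat_zero_code nat_neq_iff)
qed

text \<open>Supplies the place of comparison for \<open>inactive_if_top_less\<close>: the
  highest-ranked difference.\<close>

lemma top_difference:
  assumes "f \<in> B" "g \<in> B" "f \<noteq> g"
  obtains i where "i \<in> E" "f i \<noteq> g i" "agree_above i f g"
proof -
  let ?S = "{e \<in> E. f e \<noteq> g e}"
  have "?S \<noteq> {}" using assms B_ext by blast
  moreover have "finite ?S" using finite_E by simp
  ultimately have "Max (rank ` ?S) \<in> rank ` ?S" by (intro Max_in) auto
  then obtain i where i: "i \<in> ?S" "rank i = Max (rank ` ?S)" by auto
  have "rank e \<le> rank i" if "e \<in> ?S" for e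
    using that i(2) \<open>finite ?S\<close> by auto
  with i(1) that show ?thesis unfolding agree_above_def by (metis (mono_tags, lifting) mem_Collect_eq not_le)
qed

lemma weight_maximal:
  assumes "A \<subseteq> B" "A \<noteq> {}"
  shows "\<exists>f\<in>A. \<forall>g\<in>A. weight g \<le> weight f"
proof -
  have "finite A" using assms(1) finite_B by (rule finite_subset)
  then have "Max (weight ` A) \<in> weight ` A" using assms(2) by (intro Max_in) auto
  then obtain f where f: "f \<in> A" "weight f = Max (weight ` A)" by auto
  then have "\<forall>g\<in>A. weight g \<le> weight f"
    using \<open>finite A\<close> by simp
  with f show ?thesis by blast
qed

lemma all_active_exists:
  obtains f where "f \<in> B" "\<And>i. i \<in> E \<Longrightarrow> \<not> inactive f i"
proof -
  obtain f where "f \<in> B" and max: "\<And>g. g \<in> B \<Longrightarrow> weight g \<le> weight f"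
    using weight_maximal[OF order_refl B_nonempty] by auto
  moreover have "\<not> inactive f i" if "i \<in> E" for i
  proof
    assume "inactive f i"
    then obtain j where j: "j \<in> E" "rank j < rank i" "0 < f j" "shift f j i \<in> B"
      by (auto simp: inactive_def)
    show False using weight_less_shift[OF j(1) that j(2), of f] j(3) max[OF j(4)] by simp
  qed
  ultimately show ?thesis using that by blast
qed

section \<open>Comparison with a member that has no inactive elements\<close>

context
  fixes f0 assumes f0: "f0 \<in> B" and f0_active: "\<And>i. i \<in> E \<Longrightarrow> \<not> inactive f0 i"
begin

text \<open>A larger value would make \<open>i\<close> inactive for \<open>f0\<close>, by
  \<open>inactive_if_top_less\<close> with \<open>f0\<close> as the smaller member.\<close>

lemma le_all_active:
  assumes "g \<in> B" "i \<in> E" "agree_above i g f0"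
  shows "g i \<le> f0 i"
proof (rule ccontr)
  assume "\<not> ?thesis"
  then have "inactive f0 i"
    using assms f0 by (intro inactive_if_top_less[of f0 g]) (auto simp: agree_above_def)
  then show False using f0_active assms(2) by blast
qed

text \<open>The shifted function would still agree with \<open>f0\<close> above \<open>i\<close> but
  exceed it at \<open>i\<close>, against \<open>le_all_active\<close>.\<close>

lemma shift_to_above:
  assumes "f \<in> B" "k \<in> E" "agree_above k f f0" "i \<in> E" "j \<noteq> i" "rank k < rank i" "rank j < rank i"
  shows "shift f j i \<notin> B"
proof
  assume *: "shift f j i \<in> B"
  have "agree_above i (shift f j i) f0"
    using assms by (auto simp: agree_above_def shift_apply)
  from le_all_active[OF * assms(4) this] have "f i + 1 \<le> f0 i"
    using assms(5) by (simp add: shift_apply)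
  moreover have "f i = f0 i" using assms by (auto simp: agree_above_def)
  ultimately show False by simp
qed

text \<open>Descend from \<open>f0 k\<close> one unit at a time: \<open>release\<close> takes a unit
  from \<open>k\<close>, and by \<open>shift_to_above\<close> it cannot land above \<open>k\<close>,
  so agreement with \<open>f0\<close> there persists.\<close>

lemma prescribed_value_exists:
  assumes "k \<in> E" "x \<le> f0 k"
  shows "\<exists>f\<in>B. f k = x \<and> agree_above k f f0"
  using assms(2)
proof (induction rule: inc_induct)
  case base
  show ?case using f0 by (auto simp: agree_above_def)
next
  case (step x)
  then obtain f where f: "f \<in> B" "f k = Suc x" "agree_above k f f0" by blast
  then obtain j where j: "j \<in> E" "j \<noteq> k" "shift f k j \<in> B"
    using release[of f k] assms(1) by auto
  have "\<not> rank k < rank j"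
    using shift_to_above[OF f(1) assms(1) f(3) j(1), of k] j by auto
  moreover have "shift f k j k = x" using f(2) j(2) by (simp add: shift_apply)
  moreover have "agree_above k (shift f k j) f0"
    using f(3) calculation(1) j(2) by (auto simp: agree_above_def shift_apply)
  ultimately show ?case using j(3) by blast
qed

text \<open>Choose a member of maximal weight among those with value \<open>x\<close> at
  \<open>k\<close> that agree with \<open>f0\<close> above \<open>k\<close>. Then \<open>k\<close>
  is inactive because \<open>x < f0 k\<close>. Above \<open>k\<close>, inactivity contradicts
  \<open>shift_to_above\<close>; below \<open>k\<close>, the transfer would stay in the class and
  increase the weight.\<close>

lemma one_inactive_exists:
  assumes "k \<in> E" "x < f0 k"
  shows "\<exists>f\<in>B. f k = x \<and> {i \<in> E. inactive f i} = {k}"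
proof -
  let ?A = "{f \<in> B. f k = x \<and> agree_above k f f0}"
  have "?A \<noteq> {}" using prescribed_value_exists[OF assms(1), of x] assms(2) by auto
  then obtain f where f: "f \<in> ?A" and max: "\<And>g. g \<in> ?A \<Longrightarrow> weight g \<le> weight f"
    using weight_maximal[of ?A] by auto
  have "inactive f k"
    using f f0 assms by (intro inactive_if_top_less[of f f0]) auto
  moreover have "i = k" if i: "i \<in> E" "inactive f i" for i
  proof (rule ccontr)
    assume "i \<noteq> k"
    obtain j where j: "j \<in> E" "rank j < rank i" "0 < f j" "shift f j i \<in> B"
      using i(2) by (auto simp: inactive_def)
    have "j \<noteq> i" using j(2) by auto
    have "rank i \<noteq> rank k" using \<open>i \<noteq> k\<close> i(1) assms(1) inj_rank by (auto dest: inj_onD)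
    moreover have "\<not> rank k < rank i"
      using shift_to_above[of f k i j] f i j \<open>j \<noteq> i\<close> assms(1) by auto
    ultimately have "rank i < rank k" by simp
    \<comment> \<open>The donor is ranked below \<open>i\<close>, hence below \<open>k\<close>, so
      the transfer keeps the value \<open>x\<close> at \<open>k\<close>.\<close>
    then have "j \<noteq> k" using j(2) by auto
    have "agree_above k (shift f j i) f0"
      using f \<open>rank i < rank k\<close> j(2) \<open>j \<noteq> i\<close> by (auto simp: agree_above_def shift_apply)
    then have "shift f j i \<in> ?A"
      using f j(4) \<open>i \<noteq> k\<close> \<open>j \<noteq> k\<close> \<open>j \<noteq> i\<close> by (simp add: shift_apply)
    then show False
      using max[of "shift f j i"] weight_less_shift[OF j(1) i(1) j(2), of f] j(3) by simp
  qed
  ultimately have "{i \<in> E. inactive f i} = {k}" using assms(1) by blast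
  with f show ?thesis by blast
qed

text \<open>At its top difference from \<open>f0\<close>, \<open>f\<close> is smaller and therefore
  inactive, so this difference is at \<open>k\<close>.\<close>

lemma one_inactive_less:
  assumes "f \<in> B" "{i \<in> E. inactive f i} = {k}"
  shows "f k < f0 k"
proof -
  have k: "k \<in> E" "inactive f k" using assms(2) by auto
  then have "f \<noteq> f0" using f0_active by blast
  then obtain i where i: "i \<in> E" "f i \<noteq> f0 i" "agree_above i f f0"
    using top_difference[OF assms(1) f0] by blast
  then have "f i < f0 i" using le_all_active[OF assms(1)] by (simp add: order_less_le)
  then have "inactive f i" using inactive_if_top_less[OF assms(1) f0] i by blast
  then have "i = k" using assms(2) i(1) by blast
  then show ?thesis using \<open>f i < f0 i\<close> by simp
qed

text \<open>At the top difference the smaller of the two functions is inactive; that place must be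
  \<open>k\<close>, where they coincide.\<close>

lemma one_inactive_unique:
  assumes "f \<in> B" "{i \<in> E. inactive f i} = {k}" "g \<in> B" "{i \<in> E. inactive g i} = {k}" "f k = g k"
  shows "f = g"
proof (rule ccontr)
  assume "f \<noteq> g"
  then obtain i where i: "i \<in> E" "f i \<noteq> g i" "agree_above i f g"
    using top_difference[OF assms(1,3)] by blast
  have "inactive f i \<or> inactive g i"
  proof (cases "f i < g i")
    case True
    then show ?thesis using inactive_if_top_less[OF assms(1,3)] i by blast
  next
    case False
    then have "g i < f i" using i(2) by simp
    moreover have "agree_above i g f" using i(3) by (auto simp: agree_above_def)
    ultimately show ?thesis using inactive_if_top_less[OF assms(3,1)] i(1) by blast
  qed
  then have "i = k" using assms(2,4) i(1) by blast
  then show False using i(2) assms(5) by simp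
qed

lemma card_one_inactive:
  "card {f \<in> B. card {i \<in> E. inactive f i} = 1} = (\<Sum>k\<in>E. f0 k)"
proof -
  \<comment> \<open>The members sorted by their only inactive element; evaluation at
    \<open>k\<close> maps \<open>C k\<close> bijectively onto the values below
    \<open>f0 k\<close>.\<close>
  define C where "C k = {f \<in> B. {i \<in> E. inactive f i} = {k}}" for k
  have "bij_betw (\<lambda>f. f k) (C k) {..<f0 k}" if "k \<in> E" for k
    unfolding bij_betw_def
  proof
    show "inj_on (\<lambda>f. f k) (C k)"
      by (rule inj_onI) (auto simp: C_def intro: one_inactive_unique)
    show "(\<lambda>f. f k) ` C k = {..<f0 k}"
    proof
      show "(\<lambda>f. f k) ` C k \<subseteq> {..<f0 k}"
        using one_inactive_less by (auto simp: C_def)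
      show "{..<f0 k} \<subseteq> (\<lambda>f. f k) ` C k"
        using one_inactive_exists[OF that] by (fastforce simp: C_def)
    qed
  qed
  then have card_C: "card (C k) = f0 k" if "k \<in> E" for k
    using bij_betw_same_card that by fastforce
  have "{f \<in> B. card {i \<in> E. inactive f i} = 1} = (\<Union>k\<in>E. C k)"
    by (auto simp: C_def card_1_singleton_iff)
  moreover have "card (\<Union>k\<in>E. C k) = (\<Sum>k\<in>E. card (C k))"
    by (rule card_UN_disjoint) (auto simp: C_def finite_E finite_B)
  ultimately show ?thesis using card_C by simp
qed

end

theorem card_exactly_one_inactive:
  assumes "\<And>f. f \<in> B \<Longrightarrow> (\<Sum>e\<in>E. f e) = s"
  shows "card {f \<in> B. card {i \<in> E. inactive f i} = 1} = s"
proof -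
  obtain f0 where f0: "f0 \<in> B" "\<And>i. i \<in> E \<Longrightarrow> \<not> inactive f0 i"
    by (rule all_active_exists) blast
  then show ?thesis using card_one_inactive[OF f0] assms by simp
qed

end

section \<open>Degree vectors of spanning trees\<close>

text \<open>Edges will be oriented from hyperedges to vertices, so for a hyperedge this is the
  degree in the undirected graph.\<close>

definition deg :: "'a rel \<Rightarrow> 'a \<Rightarrow> nat" where
  "deg D e = card {d \<in> D. fst d = e}"

lemma deg_insert:
  assumes "finite D" "d \<notin> D"
  shows "deg (insert d D) e = deg D e + of_bool (e = fst d)"
proof -
  have "{x \<in> insert d D. fst x = e} = (if e = fst d then insert d {x \<in> D. fst x = e} else {x \<in> D. fst x = e})"
    by auto
  with assms show ?thesis by (simp add: deg_def)
qed

text \<open>Adding the indicators on both sides avoids truncated subtraction and also covers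
  \<open>fst d = fst d'\<close>.\<close>

lemma deg_swap:
  assumes "finite D" "d \<notin> D" "d' \<in> D"
  shows "deg (insert d (D - {d'})) e + of_bool (e = fst d') = deg D e + of_bool (e = fst d)"
  using deg_insert[of "D - {d'}" d e] deg_insert[of "D - {d'}" d' e] assms
  by (simp add: insert_absorb)

lemma sum_deg:
  assumes "finite D" "finite E" "fst ` D \<subseteq> E"
  shows "(\<Sum>e\<in>E. deg D e) = card D"
  unfolding deg_def using sum.group[OF assms, of "\<lambda>_. 1 :: nat"] by simp

locale hypergraph =
  fixes V E :: "'a set" and I :: "'a rel"
  assumes finite_V: "finite V" and finite_E: "finite E" and V_nonempty: "V \<noteq> {}"
    and disjoint: "V \<inter> E = {}"
    and I_subset: "I \<subseteq> E \<times> V"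
begin

definition realizes :: "'a rel \<Rightarrow> ('a \<Rightarrow> nat) \<Rightarrow> bool" where
  "realizes D f \<longleftrightarrow> D \<subseteq> I \<and> tree_edges (V \<union> E) D \<and> (\<forall>e\<in>E. deg D e = f e + 1)"

definition hypertrees :: "('a \<Rightarrow> nat) set" where
  "hypertrees = {f \<in> E \<rightarrow>\<^sub>E UNIV. \<exists>D. realizes D f}"

lemma finite_verts: "finite (V \<union> E)" and verts_nonempty: "V \<union> E \<noteq> {}"
  using finite_V finite_E V_nonempty by auto

text \<open>Each of the \<open>card V + card E - 1\<close> tree edges has one end in
  \<open>E\<close>, and each hyperedge value is its degree minus one.\<close>

lemma sum_hypertree:
  assumes "f \<in> hypertrees"
  shows "(\<Sum>e\<in>E. f e) = card V - 1"
proof -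
  obtain D where D: "D \<subseteq> I" "tree_edges (V \<union> E) D" "\<And>e. e \<in> E \<Longrightarrow> deg D e = f e + 1"
    using assms by (auto simp: hypertrees_def realizes_def)
  have finD: "finite D" using finite_tree_edges[OF finite_verts D(2)] .
  have "fst ` D \<subseteq> E" using D(1) I_subset by auto
  then have "card D = (\<Sum>e\<in>E. f e + 1)"
    using sum_deg[OF finD finite_E] D(3) by simp
  also have "\<dots> = (\<Sum>e\<in>E. f e) + card E" using sum.distrib[of f "\<lambda>_. 1" E] by simp
  finally show ?thesis
    using card_tree_edges[OF finite_verts verts_nonempty D(2)]
      card_Un_disjoint[OF finite_V finite_E disjoint] by simp
qed

text \<open>Turns the subtraction-free degree condition of the exchange argument into membership of
  \<open>shift f j i\<close>.\<close>

lemma shift_in_hypertrees: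
  assumes f: "f \<in> hypertrees" and ij: "i \<in> E" "j \<in> E" "i \<noteq> j" "0 < f j"
    and D: "D \<subseteq> I" "tree_edges (V \<union> E) D"
    and deg: "\<And>e. e \<in> E \<Longrightarrow> deg D e + of_bool (e = j) = f e + 1 + of_bool (e = i)"
  shows "shift f j i \<in> hypertrees"
proof -
  have "deg D e = shift f j i e + 1" if "e \<in> E" for e
    using deg[OF that] ij(3,4) by (auto simp: shift_def split: if_splits)
  then have "realizes D (shift f j i)" using D by (simp add: realizes_def)
  moreover have "shift f j i \<in> E \<rightarrow>\<^sub>E UNIV"
    using f ij(1,2) by (auto simp: hypertrees_def shift_def PiE_iff extensional_def)
  ultimately show ?thesis by (auto simp: hypertrees_def)
qed

text \<open>
  The invariant: \<open>D\<close> realizes \<open>f\<close> with one unit moved from \<open>j\<close> to \<open>i\<close>. Every further exchange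
  step adds an edge of \<open>D'\<close> at \<open>j\<close>, so that \<open>D\<close> comes closer to \<open>D'\<close>.
\<close>

lemma exchange_trees:
  assumes "tree_edges (V \<union> E) D'" "D' \<subseteq> I" "\<And>e. e \<in> E \<Longrightarrow> deg D' e = g e + 1"
    and "i \<in> E" "f i < g i"
    and "tree_edges (V \<union> E) D" "D \<subseteq> I" "j \<in> E" "deg D j < deg D' j"
    and "\<And>e. e \<in> E \<Longrightarrow> deg D e + of_bool (e = j) = f e + 1 + of_bool (e = i)"
  shows "\<exists>l\<in>E. g l < f l \<and> (\<exists>D. D \<subseteq> I \<and> tree_edges (V \<union> E) D \<and>
    (\<forall>e\<in>E. deg D e + of_bool (e = l) = f e + 1 + of_bool (e = i)))"
  using assms(6-)
proof (induction "card (D' - D)" arbitrary: D j rule: less_induct)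
  case less
  have finD: "finite D" and finD': "finite D'"
    using finite_tree_edges[OF finite_verts] less.prems(1) assms(1) by auto
  have "\<not> {x \<in> D'. fst x = j} \<subseteq> {x \<in> D. fst x = j}"
    using less.prems(4) finD card_mono[of "{x \<in> D. fst x = j}" "{x \<in> D'. fst x = j}"]
    by (auto simp: deg_def)
  then obtain d where d: "d \<in> D' - D" "fst d = j" by auto
  obtain d' where d': "d' \<in> D - D'" "tree_edges (V \<union> E) (insert d (D - {d'}))"
    by (rule tree_edges_exchange[OF finite_verts verts_nonempty less.prems(1) assms(1) d(1)])
  define D1 where "D1 = insert d (D - {d'})"
  define l where "l = fst d'"
  have D1: "D1 \<subseteq> I" "tree_edges (V \<union> E) D1"
    using less.prems(2) assms(2) d d' by (auto simp: D1_def)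
  have "l \<in> E" using d'(1) less.prems(2) I_subset by (auto simp: l_def)
  have swap: "deg D1 e + of_bool (e = l) = deg D e + of_bool (e = j)" for e
    unfolding D1_def l_def d(2)[symmetric] by (rule deg_swap) (use finD d d' in auto)
  then have deg1: "deg D1 e + of_bool (e = l) = f e + 1 + of_bool (e = i)" if "e \<in> E" for e
    using less.prems(5)[OF that] by simp
  show ?case
  proof (cases "g l < f l")
    case True
    then show ?thesis using \<open>l \<in> E\<close> D1 deg1 by blast
  next
    case False
    \<comment> \<open>Either \<open>l = i\<close>, with degree \<open>f i + 1\<close> in
      \<open>D1\<close>, or the degree of \<open>l\<close> has dropped to \<open>f l\<close>, at
      most \<open>g l\<close>. In both cases \<open>l\<close> lacks an edge of \<open>D'\<close> and
      takes over the role of \<open>j\<close>.\<close>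
    then have "deg D1 l < deg D' l"
      using deg1[OF \<open>l \<in> E\<close>] assms(3)[OF \<open>l \<in> E\<close>] assms(5) by (cases "l = i") auto
    moreover have "D' - D1 \<subset> D' - D" using d d' by (auto simp: D1_def)
    then have "card (D' - D1) < card (D' - D)" using finD' by (intro psubset_card_mono) auto
    ultimately show ?thesis
      using less.hyps[OF _ D1(2,1) \<open>l \<in> E\<close> _ deg1] by blast
  qed
qed

lemma hypertrees_exchange:
  assumes "f \<in> hypertrees" "g \<in> hypertrees" "i \<in> E" "f i < g i"
  shows "\<exists>j\<in>E. g j < f j \<and> shift f j i \<in> hypertrees"
proof -
  obtain D where D: "D \<subseteq> I" "tree_edges (V \<union> E) D" "\<And>e. e \<in> E \<Longrightarrow> deg D e = f e + 1"
    using assms(1) by (auto simp: hypertrees_def realizes_def)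
  obtain D' where D': "D' \<subseteq> I" "tree_edges (V \<union> E) D'" "\<And>e. e \<in> E \<Longrightarrow> deg D' e = g e + 1"
    using assms(2) by (auto simp: hypertrees_def realizes_def)
  have "deg D i < deg D' i" using D(3) D'(3) assms(3,4) by simp
  \<comment> \<open>The invariant of \<open>exchange_trees\<close> holds at the start with
    \<open>j = i\<close>, where nothing has moved yet.\<close>
  moreover have "deg D e + of_bool (e = i) = f e + 1 + of_bool (e = i)" if "e \<in> E" for e
    using D(3)[OF that] by simp
  ultimately obtain l M where l: "l \<in> E" "g l < f l" and M: "M \<subseteq> I" "tree_edges (V \<union> E) M"
    "\<And>e. e \<in> E \<Longrightarrow> deg M e + of_bool (e = l) = f e + 1 + of_bool (e = i)"
    using exchange_trees[where f = f and g = g, OF D'(2,1,3) assms(3,4) D(2,1) assms(3)] by blast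
  have "i \<noteq> l" using l(2) assms(4) by auto
  then have "shift f l i \<in> hypertrees"
    using shift_in_hypertrees[OF assms(1,3) l(1) _ _ M] l(2) by simp
  then show ?thesis using l by blast
qed

text \<open>Since \<open>f i\<close> is positive, the tree has two edges at \<open>i\<close>. Drop
  one of them; the other still attaches \<open>i\<close>, and everything else is connected without
  \<open>i\<close>, so the tree can be repaired by an edge at another hyperedge.\<close>

lemma hypertrees_release:
  assumes "f \<in> hypertrees" "i \<in> E" "0 < f i"
    and rest: "spanning_edges (V \<union> E - {i}) {d \<in> I. fst d \<noteq> i}"
  shows "\<exists>j\<in>E. j \<noteq> i \<and> shift f i j \<in> hypertrees"
proof -
  obtain D where D: "D \<subseteq> I" "tree_edges (V \<union> E) D" "\<And>e. e \<in> E \<Longrightarrow> deg D e = f e + 1"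
    using assms(1) by (auto simp: hypertrees_def realizes_def)
  have finD: "finite D" using finite_tree_edges[OF finite_verts D(2)] .
  have "2 \<le> card {d \<in> D. fst d = i}" using D(3)[OF assms(2)] assms(3) by (simp add: deg_def)
  then obtain T where "T \<subseteq> {d \<in> D. fst d = i}" "card T = 2"
    by (rule obtain_subset_with_card_n)
  then obtain d0 d1 where "T = {d0, d1}" "d0 \<noteq> d1" by (auto simp: card_2_iff)
  with \<open>T \<subseteq> _\<close> have d: "d0 \<in> D" "d1 \<in> D" "fst d0 = i" "fst d1 = i" "d0 \<noteq> d1" by simp_all
  \<comment> \<open>The edges allowed for the repair: all edges away from \<open>i\<close>, and what
    is left of the tree.\<close>
  define C where "C = {d \<in> I. fst d \<noteq> i} \<union> (D - {d0})"
  obtain v where v: "d1 = (i, v)" using d(4) by (cases d1) auto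
  have "(i, v) \<in> I" using D(1) d(2) v by blast
  then have "v \<in> V" using I_subset by blast
  then have "v \<noteq> i" using disjoint assms(2) by blast
  have "(i, v) \<in> C" using d(2,5) v by (auto simp: C_def)
  then have iv: "(i, v) \<in> linked C" by (rule linked_edge)
  have le: "linked {d \<in> I. fst d \<noteq> i} \<subseteq> linked C"
    by (rule linked_mono) (auto simp: C_def)
  have star: "(v, x) \<in> linked C" if "x \<in> V \<union> E" for x
  proof (cases "x = i")
    case True
    then show ?thesis using linked_sym[OF iv] by simp
  next
    case False
    then have "(v, x) \<in> linked {d \<in> I. fst d \<noteq> i}"
      using rest that \<open>v \<in> V\<close> \<open>v \<noteq> i\<close> by (auto simp: spanning_edges_def)
    then show ?thesis using le by blast
  qed
  have "C \<subseteq> (V \<union> E) \<times> (V \<union> E)" using D(1) I_subset by (auto simp: C_def)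
  moreover have "(x, y) \<in> linked C" if "x \<in> V \<union> E" "y \<in> V \<union> E" for x y
    using linked_trans[OF linked_sym[OF star[OF that(1)]] star[OF that(2)]] .
  ultimately have "spanning_edges (V \<union> E) C" by (auto simp: spanning_edges_def)
  then obtain d2 where d2: "d2 \<in> C" "d2 \<notin> D - {d0}" "tree_edges (V \<union> E) (insert d2 (D - {d0}))"
    by (rule tree_edges_reconnect[OF finite_verts verts_nonempty D(2) d(1)]) (auto simp: C_def)
  have "d2 \<in> I" "fst d2 \<noteq> i" using d2(1,2) by (auto simp: C_def)
  \<comment> \<open>The only edge of \<open>D\<close> outside \<open>D - {d0}\<close> is
    \<open>d0\<close>, which is at \<open>i\<close>.\<close>
  then have "d2 \<notin> D" "fst d2 \<in> E" using d2(2) d(3) I_subset by auto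
  have "deg (insert d2 (D - {d0})) e + of_bool (e = i) = f e + 1 + of_bool (e = fst d2)"
    if "e \<in> E" for e
    using deg_swap[OF finD \<open>d2 \<notin> D\<close> d(1), of e] D(3)[OF that] d(3) by simp
  moreover have "insert d2 (D - {d0}) \<subseteq> I" using \<open>d2 \<in> I\<close> D(1) by auto
  ultimately have "shift f i (fst d2) \<in> hypertrees"
    using shift_in_hypertrees[OF assms(1) \<open>fst d2 \<in> E\<close> assms(2) \<open>fst d2 \<noteq> i\<close> assms(3) _ d2(3)]
    by blast
  then show ?thesis using \<open>fst d2 \<in> E\<close> \<open>fst d2 \<noteq> i\<close> by blast
qed

text \<open>In any spanning tree each hyperedge is linked to some vertex of \<open>V\<close>, so its
  degree is positive and subtracting one is not truncated.\<close>

lemma hypertrees_nonempty: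
  assumes "spanning_edges (V \<union> E) I"
  shows "hypertrees \<noteq> {}"
proof -
  obtain D where D: "D \<subseteq> I" "tree_edges (V \<union> E) D"
    by (rule tree_edges_between[OF finite_verts assms, of "{}"]) auto
  have finD: "finite D" using finite_tree_edges[OF finite_verts D(2)] .
  have pos: "0 < deg D e" if e: "e \<in> E" for e
  proof -
    obtain v where v: "v \<in> V" using V_nonempty by blast
    have "v \<noteq> e" using v e disjoint by blast
    have "(e, v) \<in> linked D" using D(2) e v by (auto simp: tree_edges_def spanning_edges_def)
    then obtain b where "(e, b) \<in> D\<^sup>s"
      by (rule linked_leaves_set[of e v D "{e}"]) (use \<open>v \<noteq> e\<close> in auto)
    moreover have "(b, e) \<notin> D" using D(1) I_subset e disjoint by blast
    ultimately have "(e, b) \<in> D" by (simp add: in_symcl_iff)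
    then have "{d \<in> D. fst d = e} \<noteq> {}" by auto
    then show ?thesis using finD by (simp add: deg_def card_gt_0_iff)
  qed
  define f where "f = restrict (\<lambda>e. deg D e - 1) E"
  have "realizes D f" using D pos by (auto simp: realizes_def f_def Suc_leI)
  then have "f \<in> hypertrees" by (auto simp: hypertrees_def f_def)
  then show ?thesis by blast
qed

lemma finite_hypertree_set: "finite hypertrees"
proof (rule finite_subset)
  show "hypertrees \<subseteq> E \<rightarrow>\<^sub>E {..card V - 1}"
  proof
    fix f assume f: "f \<in> hypertrees"
    have "f e \<le> card V - 1" if "e \<in> E" for e
      using member_le_sum[OF that, of f] finite_E sum_hypertree[OF f] by simp
    then show "f \<in> E \<rightarrow>\<^sub>E {..card V - 1}" using f by (auto simp: hypertrees_def)
  qed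
  show "finite (E \<rightarrow>\<^sub>E {..card V - 1})" using finite_E by (intro finite_PiE) auto
qed

lemma exchange_family_hypertrees:
  assumes "spanning_edges (V \<union> E) I" "inj_on rank E"
    and "\<And>e. e \<in> E \<Longrightarrow> spanning_edges (V \<union> E - {e}) {d \<in> I. fst d \<noteq> e}"
  shows "exchange_family E hypertrees rank"
proof
  show "finite E" by (fact finite_E)
  show "finite hypertrees" by (fact finite_hypertree_set)
  show "hypertrees \<noteq> {}" using assms(1) by (rule hypertrees_nonempty)
  show "inj_on rank E" by (fact assms(2))
  show "f = g" if "f \<in> hypertrees" "g \<in> hypertrees" "\<And>e. e \<in> E \<Longrightarrow> f e = g e" for f g
    using that unfolding hypertrees_def by (auto intro: PiE_ext)
qed (use hypertrees_exchange hypertrees_release assms(3) in auto)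

end

section \<open>Undirected graphs as symmetric digraphs\<close>

lemma symcl_symcl [simp]: "(D\<^sup>s)\<^sup>s = D\<^sup>s"
  by (auto simp: in_symcl_iff)

text \<open>Only the symmetric closure matters for connectedness, so \<open>D\<close> may orient
  each edge arbitrarily.\<close>

lemma connected_iff_spanning_edges:
  assumes "D \<subseteq> verts H \<times> verts H" "(arcs_ends H)\<^sup>s = D\<^sup>s"
  shows "connected H \<longleftrightarrow> verts H \<noteq> {} \<and> spanning_edges (verts H) D"
proof -
  have "(u, v) \<in> rtrancl_on (verts H) (D\<^sup>s) \<longleftrightarrow> (u, v) \<in> linked D"
    if "u \<in> verts H" "v \<in> verts H" for u v
    unfolding linked_def
  proof
    assume "(u, v) \<in> (D\<^sup>s)\<^sup>*"
    then show "(u, v) \<in> rtrancl_on (verts H) (D\<^sup>s)"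
      using that by (rule rtrancl_consistent_rtrancl_on) (use assms(1) in \<open>auto simp: in_symcl_iff\<close>)
  qed (rule rtrancl_on_rtranclI)
  then show ?thesis
    unfolding connected_conv assms(2) using assms(1) by (auto simp: spanning_edges_def)
qed

section \<open>Cycles as walks and acyclic edge sets\<close>

lemma pawalk_verts_start: "pcas u p v \<Longrightarrow> u \<in> set (pawalk_verts u p)"
  by (cases p) auto

lemma pawalk_verts_end: "pcas u p v \<Longrightarrow> v \<in> set (pawalk_verts u p)"
  by (induction p arbitrary: u) auto

lemma pawalk_verts_arc:
  "pcas u p v \<Longrightarrow> e \<in> set p \<Longrightarrow> fst e \<in> set (pawalk_verts u p) \<and> snd e \<in> set (pawalk_verts u p)"
  by (induction p arbitrary: u) (auto intro: pawalk_verts_start)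

lemma pcas_linked:
  assumes "pcas u p v" "set p \<subseteq> D\<^sup>s"
  shows "(u, v) \<in> linked D"
  using assms
proof (induction p arbitrary: u)
  case (Cons e p)
  have "(fst e, snd e) \<in> linked D"
    using Cons.prems(2) by (auto simp: linked_def)
  with Cons show ?case by (auto intro: linked_trans)
qed simp

lemma linked_apath:
  assumes "(u, v) \<in> linked D"
  obtains p where "pcas u p v" "set p \<subseteq> D\<^sup>s" "distinct (pawalk_verts u p)"
proof -
  \<comment> \<open>With the whole type as vertex set this is a digraph, and the library shortens a
    walk in it to a path.\<close>
  define T where "T = \<lparr>pverts = UNIV, parcs = D\<^sup>s\<rparr>"
  interpret T: pair_wf_digraph T by unfold_locales (auto simp: T_def)
  have "(u, v) \<in> rtrancl_on UNIV (D\<^sup>s)"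
    using assms unfolding linked_def by (rule rtrancl_consistent_rtrancl_on) auto
  then have "u \<rightarrow>\<^sup>*\<^bsub>with_proj T\<^esub> v" by (simp add: reachable_def T_def)
  then obtain p where "T.apath u p v" unfolding T.reachable_apath by blast
  moreover have "parcs T = D\<^sup>s" by (simp add: T_def)
  ultimately show ?thesis
    using that by (auto simp: T.apath_def T.awalk_def)
qed

text \<open>Removing an edge from a cycle of length at least 3 leaves a walk between its ends;
  conversely, a path that avoids an edge is closed by it to a cycle. The condition on
  \<open>D\<close> rules out loops and doubly oriented edges.\<close>

lemma acyclic_edges_iff_no_cycle:
  assumes T: "pair_graph T" "parcs T = D\<^sup>s" and D: "D \<inter> D\<inverse> = {}"
  shows "acyclic_edges D \<longleftrightarrow> \<not> (\<exists>p. pre_digraph.cycle (with_proj T) p \<and> 3 \<le> length p)"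
proof -
  interpret T: pair_graph T by (fact T)
  have cycle_iff: "T.cycle p \<longleftrightarrow> (\<exists>u. u \<in> pverts T \<and> set p \<subseteq> D\<^sup>s \<and> pcas u p u \<and>
      distinct (tl (pawalk_verts u p)) \<and> p \<noteq> [])" for p
    by (simp add: T.cycle_def T.awalk_def T(2))
  show ?thesis
  proof (intro iffI notI)
    assume "\<exists>p. T.cycle p \<and> 3 \<le> length p"
    then obtain p u where p: "set p \<subseteq> D\<^sup>s" "pcas u p u" "distinct (tl (pawalk_verts u p))"
        "3 \<le> length p"
      by (auto simp: cycle_iff)
    then obtain b c q where q: "p = (u, b) # (b, c) # q"
      by (cases p rule: remdups_adj.cases) auto
    have distinct: "distinct (b # pawalk_verts c q)" and cas: "pcas c q u"
      using p(2,3) q by auto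
    have "q \<noteq> []" using p(4) q by auto
    have "u \<in> set (pawalk_verts c q)" using cas by (rule pawalk_verts_end)
    \<comment> \<open>Otherwise the cycle would return along its first edge and pass
      \<open>u\<close> again at its end.\<close>
    moreover have "c \<noteq> u"
    proof
      assume "c = u"
      obtain e q' where "q = e # q'" using \<open>q \<noteq> []\<close> by (cases q) auto
      then show False using distinct cas \<open>c = u\<close> pawalk_verts_end[of "snd e" q' u] by auto
    qed
    ultimately have avoid: "set ((b, c) # q) \<subseteq> D\<^sup>s - {(u, b), (b, u)}"
      using p(1) q distinct pawalk_verts_arc[OF cas] by auto
    define d where "d = (if (u, b) \<in> D then (u, b) else (b, u))"
    have "d \<in> D" using p(1) q by (auto simp: d_def in_symcl_iff)
    have "set ((b, c) # q) \<subseteq> (D - {d})\<^sup>s"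
      using avoid by (auto simp: d_def in_symcl_iff)
    moreover have "pcas b ((b, c) # q) u" using cas by simp
    ultimately have "(b, u) \<in> linked (D - {d})" by (intro pcas_linked)
    then have "d \<in> linked (D - {d})" by (auto simp: d_def intro: linked_sym)
    moreover assume "acyclic_edges D"
    ultimately show False using acyclic_edgesD[of D "fst d" "snd d"] \<open>d \<in> D\<close> by simp
  next
    assume no_cycle: "\<not> (\<exists>p. T.cycle p \<and> 3 \<le> length p)"
    show "acyclic_edges D"
      unfolding acyclic_edges_def
    proof clarify
      fix u v assume uv: "(u, v) \<in> D" "(u, v) \<in> linked (D - {(u, v)})"
      obtain p where p: "pcas u p v" "set p \<subseteq> (D - {(u, v)})\<^sup>s" "distinct (pawalk_verts u p)"
        by (rule linked_apath[OF uv(2)])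
      have "(v, u) \<notin> D" using D uv(1) by auto
      have "p \<noteq> []" using p(1) uv(1) D by auto
      moreover have "p \<noteq> [e]" for e
        using p(1,2) \<open>(v, u) \<notin> D\<close> by (cases e) (auto simp: in_symcl_iff)
      \<comment> \<open>A path of one arc would have to use the removed edge, so it has at least two
        arcs.\<close>
      ultimately have "3 \<le> length ((v, u) # p)"
        by (cases p rule: remdups_adj.cases) auto
      moreover have "(v, u) \<in> parcs T" using uv(1) by (simp add: T(2) in_symcl_iff)
      then have "v \<in> pverts T" by (rule T.in_arcsD1)
      then have "T.cycle ((v, u) # p)"
        using p uv(1) by (auto simp: cycle_iff in_symcl_iff intro!: exI[of _ v])
      ultimately show False using no_cycle by blast
    qed
  qed
qed

section \<open>From bipartite graphs to incidence relations\<close>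

lemma symmetric_bipartite_arcs:
  assumes "sym A" "A \<subseteq> V \<times> E \<union> E \<times> V"
  shows "A = (A \<inter> E \<times> V)\<^sup>s"
  using assms by (auto simp: in_symcl_iff dest: symD)

lemma hypergraph_of_bipartite_graph:
  assumes "bipartite_graph G V E"
  shows "hypergraph V E (parcs G \<inter> E \<times> V)"
proof -
  interpret pair_graph G using assms by (simp add: bipartite_graph_def)
  show ?thesis
    using assms pair_finite_verts by unfold_locales (auto simp: bipartite_graph_def)
qed

lemma parcs_bipartite_graph:
  assumes "bipartite_graph G V E"
  shows "parcs G = (parcs G \<inter> E \<times> V)\<^sup>s"
proof (rule symmetric_bipartite_arcs)
  interpret pair_graph G using assms by (simp add: bipartite_graph_def)
  show "sym (parcs G)" by (auto intro: symI arcs_symmetric)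
  show "parcs G \<subseteq> V \<times> E \<union> E \<times> V" using assms by (simp add: bipartite_graph_def)
qed

text \<open>Spanning trees \<open>T\<close> of \<open>G\<close> correspond to tree edge sets
  \<open>D\<close> within the incidences through \<open>parcs T = D\<^sup>s\<close>; conversely,
  \<open>D\<close> keeps the arcs leaving \<open>E\<close>.\<close>

lemma hypertrees_conv:
  assumes G: "bipartite_graph G V E"
  shows "{f. hypertree G E f} = hypergraph.hypertrees V E (parcs G \<inter> E \<times> V)"
proof -
  define I where "I = parcs G \<inter> E \<times> V"
  interpret hypergraph V E I
    unfolding I_def using G by (rule hypergraph_of_bipartite_graph)
  interpret G: pair_graph G using G by (simp add: bipartite_graph_def)
  have arcs_G: "parcs G = I\<^sup>s" and verts_G: "pverts G = V \<union> E"
    and sub_G: "parcs G \<subseteq> V \<times> E \<union> E \<times> V"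
    using G parcs_bipartite_graph[OF G] by (auto simp: I_def bipartite_graph_def)
  have tree_iff: "undirected_tree T \<longleftrightarrow> tree_edges (V \<union> E) D"
    if T: "pair_graph T" "pverts T = V \<union> E" "parcs T = D\<^sup>s" and D: "D \<subseteq> I" for T D
  proof -
    have "D \<inter> D\<inverse> = {}" using D I_subset disjoint by blast
    then have "undirected_forest T \<longleftrightarrow> acyclic_edges D"
      unfolding undirected_forest_def using acyclic_edges_iff_no_cycle[OF T(1,3)] T(1) by simp
    moreover have "D \<subseteq> (V \<union> E) \<times> (V \<union> E)" using D I_subset by blast
    then have "connected (with_proj T) \<longleftrightarrow> spanning_edges (V \<union> E) D"
      using connected_iff_spanning_edges[of D "with_proj T"] T(2,3) verts_nonempty by simp
    ultimately show ?thesis by (simp add: undirected_tree_def tree_edges_def)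
  qed
  have degree: "out_degree (with_proj T) e = deg D e"
    if "parcs T = D\<^sup>s" "D \<subseteq> I" "e \<in> E" for T D e
  proof -
    have "{a \<in> D\<^sup>s. fst a = e} = {d \<in> D. fst d = e}"
    proof -
      have "e \<notin> V" using that(3) disjoint by blast
      \<comment> \<open>No edge of \<open>D\<close> ends in a hyperedge, so the symmetric closure
        adds no arc leaving \<open>e\<close>.\<close>
      then have "(b, e) \<notin> D" for b using that(2) I_subset by blast
      then show ?thesis by (auto simp: in_symcl_iff)
    qed
    then show ?thesis by (simp add: out_degree_def out_arcs_def deg_def that(1))
  qed
  have "(\<exists>T. undirected_spanning_tree T G \<and> (\<forall>e\<in>E. out_degree (with_proj T) e = f e + 1))
      \<longleftrightarrow> (\<exists>D. realizes D f)" for f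
  proof
    assume "\<exists>T. undirected_spanning_tree T G \<and> (\<forall>e\<in>E. out_degree (with_proj T) e = f e + 1)"
    then obtain T where T: "undirected_tree T" "parcs T \<subseteq> parcs G" "pverts T = V \<union> E"
      and deg: "\<And>e. e \<in> E \<Longrightarrow> out_degree (with_proj T) e = f e + 1"
      by (auto simp: undirected_spanning_tree_def spanning_def subgraph_def verts_G)
    have pgT: "pair_graph T" using T(1) by (simp add: undirected_tree_def undirected_forest_def)
    interpret T: pair_graph T by (fact pgT)
    define D where "D = parcs T \<inter> E \<times> V"
    have "sym (parcs T)" by (auto intro: symI T.arcs_symmetric)
    then have arcs_T: "parcs T = D\<^sup>s"
      unfolding D_def by (rule symmetric_bipartite_arcs) (use T(2) sub_G in blast)
    have "D \<subseteq> I" using T(2) by (auto simp: D_def I_def)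
    then show "\<exists>D. realizes D f"
      using tree_iff[OF pgT T(3) arcs_T] T(1) degree[OF arcs_T] deg
      by (auto simp: realizes_def intro!: exI[of _ D])
  next
    assume "\<exists>D. realizes D f"
    then obtain D where D: "D \<subseteq> I" "tree_edges (V \<union> E) D" "\<And>e. e \<in> E \<Longrightarrow> deg D e = f e + 1"
      by (auto simp: realizes_def)
    define T where "T = \<lparr>pverts = V \<union> E, parcs = D\<^sup>s\<rparr>"
    have T: "pverts T = V \<union> E" "parcs T = D\<^sup>s" by (simp_all add: T_def)
    have "parcs T \<subseteq> parcs G" using D(1) by (auto simp: T arcs_G in_symcl_iff)
    have pgT: "pair_graph T"
    proof
      show "finite (pverts T)" using finite_verts T by simp
      show "finite (parcs T)"
        using \<open>parcs T \<subseteq> parcs G\<close> G.pair_finite_arcs by (rule finite_subset)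
      show "fst e \<noteq> snd e" if "e \<in> parcs T" for e
        using that \<open>parcs T \<subseteq> parcs G\<close> G.pair_no_loops by blast
      show "fst e \<in> pverts T" "snd e \<in> pverts T" if "e \<in> parcs T" for e
        using G.arc_fst_in_verts[of e] G.arc_snd_in_verts[of e] that \<open>parcs T \<subseteq> parcs G\<close> verts_G T(1)
        by blast+
      show "symmetric (with_proj T)"
        by (auto simp: symmetric_def T in_symcl_iff intro: symI)
    qed
    interpret T: pair_graph T by (fact pgT)
    have "spanning (with_proj T) (with_proj G)"
      using \<open>parcs T \<subseteq> parcs G\<close> T verts_G T.wf_digraph_axioms G.wf_digraph_axioms
      by (auto simp: spanning_def subgraph_def)
    then have "undirected_spanning_tree T G"
      using tree_iff[OF pgT T D(1)] D(2) by (simp add: undirected_spanning_tree_def)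
    then show "\<exists>T. undirected_spanning_tree T G \<and> (\<forall>e\<in>E. out_degree (with_proj T) e = f e + 1)"
      using degree[OF T(2) D(1)] D(3) by auto
  qed
  then have "{f. hypertree G E f} = hypertrees"
    unfolding hypertrees_def hypertree_def by auto
  then show ?thesis by (simp only: I_def)
qed

text \<open>The rank of an element is the size of its down-set.\<close>

lemma linear_order_rank:
  assumes "finite E" "linear_order_on E r"
  obtains rank :: "'a \<Rightarrow> nat" where
    "\<And>x y. x \<in> E \<Longrightarrow> y \<in> E \<Longrightarrow> rank x < rank y \<longleftrightarrow> (x, y) \<in> r \<and> x \<noteq> y"
proof -
  define rank where "rank e = card {x \<in> E. (x, e) \<in> r}" for e
  have r: "refl_on E r" "trans r" "antisym r" "total_on E r"
    using assms(2) by (auto simp: order_on_defs)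
  have less: "rank x < rank y" if "(x, y) \<in> r" "x \<noteq> y" "y \<in> E" for x y
    unfolding rank_def
  proof (intro psubset_card_mono psubsetI)
    show "finite {z \<in> E. (z, y) \<in> r}" using assms(1) by simp
    show "{z \<in> E. (z, x) \<in> r} \<subseteq> {z \<in> E. (z, y) \<in> r}"
      using that(1) r(2) by (auto dest: transD)
    have "(y, y) \<in> r" using r(1) that(3) by (rule refl_onD)
    moreover have "(y, x) \<notin> r" using that(1,2) r(3) by (auto dest: antisymD)
    ultimately show "{z \<in> E. (z, x) \<in> r} \<noteq> {z \<in> E. (z, y) \<in> r}" using that(3) by blast
  qed
  have "rank x < rank y \<longleftrightarrow> (x, y) \<in> r \<and> x \<noteq> y" if xy: "x \<in> E" "y \<in> E" for x y
  proof
    assume lt: "rank x < rank y"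
    then have "x \<noteq> y" by auto
    moreover have "(y, x) \<notin> r" using less[of y x] \<open>x \<noteq> y\<close> xy(1) lt by auto
    ultimately show "(x, y) \<in> r \<and> x \<noteq> y" using r(4) xy by (auto simp: total_on_def)
  qed (use less xy(2) in auto)
  then show ?thesis by (rule that)
qed

theorem theorem45:
  fixes G :: "'a pair_pre_digraph" and V E :: "'a set" and r :: "'a rel"
  assumes "bipartite_graph G V E"
    and "connected (with_proj G)"
    and "\<And>e. e \<in> E \<Longrightarrow> connected (pre_digraph.del_vert (with_proj G) e)"
    and "linear_order_on E r"
  shows "coeff (exterior_polynomial G E r) 1 = int (card V) - 1"
proof -
  define I where "I = parcs G \<inter> E \<times> V"
  interpret hypergraph V E I
    unfolding I_def using assms(1) by (rule hypergraph_of_bipartite_graph)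
  have arcs_G: "parcs G = I\<^sup>s" and verts_G: "pverts G = V \<union> E"
    using assms(1) parcs_bipartite_graph[OF assms(1)] by (simp_all add: I_def bipartite_graph_def)
  have hypertrees: "{f. hypertree G E f} = hypertrees"
    unfolding I_def using assms(1) by (rule hypertrees_conv)
  then have hypertree_iff: "hypertree G E f \<longleftrightarrow> f \<in> hypertrees" for f by blast

  have spanning: "spanning_edges (V \<union> E) I"
    using connected_iff_spanning_edges[of I "with_proj G"] assms(2) I_subset
    by (auto simp: arcs_G verts_G)
  have spanning_del: "spanning_edges (V \<union> E - {e}) {d \<in> I. fst d \<noteq> e}" if "e \<in> E" for e
  proof -
    let ?H = "pre_digraph.del_vert (with_proj G) e"
    have "arcs_ends ?H = {d \<in> I. fst d \<noteq> e}\<^sup>s"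
      using that I_subset disjoint
      by (auto simp: arcs_ends_conv pre_digraph.del_vert_def arcs_G in_symcl_iff image_def)
    then have "(arcs_ends ?H)\<^sup>s = {d \<in> I. fst d \<noteq> e}\<^sup>s" by simp
    moreover have "verts ?H = V \<union> E - {e}" by (simp add: pre_digraph.del_vert_def verts_G)
    moreover have "{d \<in> I. fst d \<noteq> e} \<subseteq> (V \<union> E - {e}) \<times> (V \<union> E - {e})"
      using that I_subset disjoint by auto
    ultimately show ?thesis
      using connected_iff_spanning_edges[of "{d \<in> I. fst d \<noteq> e}" ?H] assms(3)[OF that] by simp
  qed

  obtain rank :: "'a \<Rightarrow> nat" where
    rank: "\<And>x y. x \<in> E \<Longrightarrow> y \<in> E \<Longrightarrow> rank x < rank y \<longleftrightarrow> (x, y) \<in> r \<and> x \<noteq> y"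
    by (rule linear_order_rank[OF finite_E assms(4)]) blast
  have "inj_on rank E"
  proof (rule inj_onI)
    fix x y assume "x \<in> E" "y \<in> E" "rank x = rank y"
    then have "\<not> ((x, y) \<in> r \<and> x \<noteq> y)" "\<not> ((y, x) \<in> r \<and> y \<noteq> x)"
      using rank by (metis less_irrefl)+
    then show "x = y"
      using assms(4) \<open>x \<in> E\<close> \<open>y \<in> E\<close> by (auto simp: order_on_defs total_on_def)
  qed
  then interpret exchange_family E hypertrees rank
    using spanning spanning_del by (intro exchange_family_hypertrees)

  have "externally_inactive G E r f e \<longleftrightarrow> inactive f e" if "e \<in> E" for f e
    using that rank[OF _ that]
    by (auto simp: externally_inactive_def inactive_def can_transfer_valence_def shift_def hypertree_iff)
  then have "external_inactivity G E r f = card {e \<in> E. inactive f e}" for f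
    unfolding external_inactivity_def by (metis (mono_tags, lifting) Collect_cong)
  \<comment> \<open>A monomial contributes to the linear coefficient exactly if its hypertree has
    one inactive hyperedge.\<close>
  then have "coeff (exterior_polynomial G E r) 1 =
      (\<Sum>f\<in>hypertrees. if card {e \<in> E. inactive f e} = 1 then 1 else 0)"
    by (simp add: exterior_polynomial_def hypertrees coeff_sum)
  also have "\<dots> = int (card {f \<in> hypertrees. card {e \<in> E. inactive f e} = 1})"
    using finite_hypertree_set by (simp add: sum.If_cases Int_def)
  also have "card {f \<in> hypertrees. card {e \<in> E. inactive f e} = 1} = card V - 1"
    using sum_hypertree by (rule card_exactly_one_inactive)
  also have "int (card V - 1) = int (card V) - 1"
    using finite_V V_nonempty by (simp add: of_nat_diff Suc_leI card_gt_0_iff)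
  finally show ?thesis .
qed

end
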